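(* Let $w_1,w_2$ be positive integers such that $r$ divides neither $w_1$ nor $w_2$. Then for every integer $n\ge 0$, as an identity of polynomials in $y_1,y_2$, $$\sum_{k=0}^{n}\binom{n}{k}B_{k,\chi,\xi^{w_1}}(w_2y_1)\,B_{n-k,\chi,\xi^{w_2}}(w_1y_2)\,w_1^{k}w_2^{n-k}=\sum_{k=0}^{n}\binom{n}{k}B_{k,\chi,\xi^{w_2}}(w_1y_1)\,B_{n-k,\chi,\xi^{w_1}}(w_2y_2)\,w_2^{k}w_1^{n-k}.$$
   Context: Let $p$ be a prime, $\mathbb{C}_p$ the completion of an algebraic closure of $\mathbb{Q}_p$, $d$ a positive integer, and $\chi$ a primitive Dirichlet character of conductor $d$, with values viewed in $\mathbb{C}_p$ via a fixed embedding $\overline{\mathbb{Q}}\to\mathbb{C}_p$ (as usual $\chi(a)=0$ if $\gcd(a,d)>1$; for $d=1$, $\chi\equiv 1$). Let $r$ be a positive integer with $\gcd(r,pd)=1$ and let $\xi\neq 1$ in $\mathbb{C}_p$ be an $r$-th root of unity. For a root of unity $\eta\in\mathbb{C}_p$, the generalized twisted Bernoulli polynomials $B_{n,\chi,\eta}(x)$ attached to $\chi$ and $\eta$ are defined by the power series identity $$\frac{t\,e^{xt}}{\eta^{d}e^{dt}-1}\sum_{a=0}^{d-1}\chi(a)\eta^{a}e^{at}=\sum_{n=0}^{\infty}B_{n,\chi,\eta}(x)\frac{t^{n}}{n!}.$$ (The left side is a power series in $t$ with coefficients in $\mathbb{C}_p[x]$, for any $\eta$.) *)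

theory Defs
  imports "HOL-Analysis.Analysis" "HOL-Computational_Algebra.Formal_Power_Series"
    "HOL-Computational_Algebra.Polynomial"
begin

section \<open>The field of $p$-adic complex numbers\<close>

locale padic_valued_field =
  fixes p :: nat and absv :: "'c::field_char_0 \<Rightarrow> real"
  assumes prime_p: "prime p"
    and absv_nonneg: "0 \<le> absv x"
    and absv_eq_0_iff: "absv x = 0 \<longleftrightarrow> x = 0"
    and absv_mult: "absv (x * y) = absv x * absv y"
    and absv_ultrametric: "absv (x + y) \<le> max (absv x) (absv y)"
    and absv_of_int: "m \<noteq> 0 \<Longrightarrow> absv (of_int m) = 1 / real p ^ multiplicity (int p) m"
begin

lemma absv_uminus: "absv (- x) = absv x"
proof -
  have "absv (- 1) = 1"
    using absv_of_int[of "- 1"] by (simp add: multiplicity_unit_right)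
  then show ?thesis
    using absv_mult[of "- 1" x] by simp
qed

sublocale Metric_space UNIV "\<lambda>x y. absv (x - y)"
proof
  fix x y z :: 'c
  show "absv (x - y) = absv (y - x)"
    using absv_uminus[of "x - y"] by simp
  show "absv (x - z) \<le> absv (x - y) + absv (y - z)"
    using absv_ultrametric[of "x - y" "y - z"] absv_nonneg[of "x - y"] absv_nonneg[of "y - z"]
    by simp
qed (simp_all add: absv_nonneg absv_eq_0_iff)

text \<open>In a complete field, the closure of the rationals is the field of $p$-adic numbers.\<close>

definition padic_numbers :: "'c set" where
  "padic_numbers = mtopology closure_of \<rat>"

definition padic_algebraic :: "'c set" where
  "padic_algebraic =
     {x. \<exists>f. f \<noteq> 0 \<and> (\<forall>i. coeff f i \<in> padic_numbers) \<and> poly f x = 0}"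

end

text \<open>
  A field is the completion of an algebraic closure of the $p$-adic numbers iff it is complete
  and the elements algebraic over its subfield of $p$-adic numbers form an algebraically closed
  and dense subset. This determines the field and its absolute value up to isometric isomorphism.
\<close>

locale padic_complex_field = padic_valued_field +
  assumes complete: "mcomplete"
    and padic_algebraic_closed:
      "(\<And>i. coeff f i \<in> padic_algebraic) \<Longrightarrow> degree f > 0
         \<Longrightarrow> \<exists>x\<in>padic_algebraic. poly f x = 0"
    and padic_algebraic_dense: "mtopology closure_of padic_algebraic = UNIV"

text \<open>
  The field of algebraic numbers is the subfield of algebraic complex numbers; values of \<open>\<iota>\<close>
  outside of it are irrelevant. Injectivity is automatic.
\<close>

definition algebraic_embedding :: "(complex \<Rightarrow> 'c::field_char_0) \<Rightarrow> bool" where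
  "algebraic_embedding \<iota> \<longleftrightarrow> \<iota> 1 = 1 \<and>
     (\<forall>x y. algebraic x \<longrightarrow> algebraic y \<longrightarrow>
        \<iota> (x + y) = \<iota> x + \<iota> y \<and> \<iota> (x * y) = \<iota> x * \<iota> y)"


section \<open>Dirichlet characters\<close>

definition dirichlet_character :: "nat \<Rightarrow> (int \<Rightarrow> complex) \<Rightarrow> bool" where
  "dirichlet_character d chi \<longleftrightarrow> d > 0 \<and>
     (\<forall>a. chi (a + int d) = chi a) \<and>
     (\<forall>a b. chi (a * b) = chi a * chi b) \<and>
     (\<forall>a. chi a = 0 \<longleftrightarrow> \<not> coprime a (int d))"

definition conductor :: "nat \<Rightarrow> (int \<Rightarrow> complex) \<Rightarrow> nat" where
  "conductor d chi = (LEAST f. f dvd d \<and>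
     (\<exists>\<psi>. dirichlet_character f \<psi> \<and> (\<forall>a. coprime a (int d) \<longrightarrow> chi a = \<psi> a)))"

definition primitive_dirichlet_character :: "nat \<Rightarrow> (int \<Rightarrow> complex) \<Rightarrow> bool" where
  "primitive_dirichlet_character d chi \<longleftrightarrow> dirichlet_character d chi \<and> conductor d chi = d"


section \<open>Generalized twisted Bernoulli polynomials\<close>

definition fps_lift_poly :: "'c::comm_ring_1 fps \<Rightarrow> 'c poly fps" where
  "fps_lift_poly F = Abs_fps (\<lambda>n. [:fps_nth F n:])"

text \<open>The series $e^{xt}$ in $t$, with $x$ the polynomial variable.\<close>

definition fps_exp_var :: "'c::field_char_0 poly fps" where
  "fps_exp_var = Abs_fps (\<lambda>n. monom (1 / fact n) n)"

definition twisted_denom :: "nat \<Rightarrow> 'c::field_char_0 \<Rightarrow> 'c fps" where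
  "twisted_denom d \<eta> = fps_const (\<eta> ^ d) * fps_exp (of_nat d) - 1"

definition twisted_char_sum :: "nat \<Rightarrow> (int \<Rightarrow> 'c::field_char_0) \<Rightarrow> 'c \<Rightarrow> 'c fps" where
  "twisted_char_sum d chi \<eta> = (\<Sum>a<d. fps_const (chi (int a) * \<eta> ^ a) * fps_exp (of_nat a))"

text \<open>
  For $d > 0$ the denominator has order at most one, so the division below is exact
  (see \<open>twisted_bernoulli_generating_function\<close>).
\<close>

definition twisted_bernoulli_fps ::
    "nat \<Rightarrow> (int \<Rightarrow> 'c::field_char_0) \<Rightarrow> 'c \<Rightarrow> 'c poly fps" where
  "twisted_bernoulli_fps d chi \<eta> =
     fps_lift_poly (fps_X / twisted_denom d \<eta>) * fps_exp_var *
     fps_lift_poly (twisted_char_sum d chi \<eta>)"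

definition twisted_bernpoly ::
    "nat \<Rightarrow> (int \<Rightarrow> 'c::field_char_0) \<Rightarrow> 'c \<Rightarrow> nat \<Rightarrow> 'c poly" where
  "twisted_bernpoly d chi \<eta> n = smult (fact n) (fps_nth (twisted_bernoulli_fps d chi \<eta>) n)"

lemma fps_lift_poly_mult: "fps_lift_poly (F * G) = fps_lift_poly F * fps_lift_poly G"
proof -
  have "[:sum f A:] = (\<Sum>i\<in>A. [:f i:])" for f :: "nat \<Rightarrow> 'a" and A
    by (auto simp: poly_eq_iff coeff_sum coeff_pCons split: nat.split)
  then show ?thesis
    by (simp add: fps_eq_iff fps_lift_poly_def fps_mult_nth mult.commute)
qed

lemma fps_lift_poly_X: "fps_lift_poly fps_X = fps_X"
  by (auto simp: fps_eq_iff fps_lift_poly_def fps_X_def one_pCons)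

lemma twisted_denom_dvd_X:
  assumes "d > 0"
  shows "twisted_denom d \<eta> dvd fps_X"
proof -
  have "\<not> (fps_nth (twisted_denom d \<eta>) 0 = 0 \<and> fps_nth (twisted_denom d \<eta>) 1 = 0)"
    using assms by (auto simp: twisted_denom_def power_0_left)
  then obtain i where i: "i \<le> 1" "fps_nth (twisted_denom d \<eta>) i \<noteq> 0"
    by (meson le_refl zero_le_one)
  then have "twisted_denom d \<eta> \<noteq> 0" "subdegree (twisted_denom d \<eta>) \<le> 1"
    using subdegree_leI[of "twisted_denom d \<eta>" i] by auto
  then show ?thesis
    by (simp add: fps_dvd_iff)
qed

theorem twisted_bernoulli_generating_function:
  assumes "d > 0"
  shows "fps_lift_poly (twisted_denom d \<eta>) *
           Abs_fps (\<lambda>n. smult (1 / fact n) (twisted_bernpoly d chi \<eta> n)) =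
         fps_X * fps_exp_var * fps_lift_poly (twisted_char_sum d chi \<eta>)"
proof -
  have "Abs_fps (\<lambda>n. smult (1 / fact n) (twisted_bernpoly d chi \<eta> n)) =
        twisted_bernoulli_fps d chi \<eta>"
    by (simp add: fps_eq_iff twisted_bernpoly_def)
  moreover have "fps_lift_poly (twisted_denom d \<eta>) * fps_lift_poly (fps_X / twisted_denom d \<eta>) =
                 fps_X"
    using twisted_denom_dvd_X[OF assms, of \<eta>]
    by (simp flip: fps_lift_poly_mult add: fps_lift_poly_X)
  ultimately show ?thesis
    by (simp add: twisted_bernoulli_fps_def flip: mult.assoc)
qed


section \<open>Polynomials in two variables\<close>

definition poly_y1 :: "'c::comm_ring_1 poly poly" where
  "poly_y1 = [:[:0, 1:]:]"

definition poly_y2 :: "'c::comm_ring_1 poly poly" where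
  "poly_y2 = [:0, 1:]"

text \<open>Substitution of a bivariate polynomial into a univariate one.\<close>

definition subst_bivar :: "'c::comm_ring_1 poly \<Rightarrow> 'c poly poly \<Rightarrow> 'c poly poly" where
  "subst_bivar f g = poly (map_poly (\<lambda>c. [:[:c:]:]) f) g"

end

theory Submission
  imports Defs
begin

text \<open>
  With \<open>F\<^sub>i t = t / (\<xi>\<^bsup>d w\<^sub>i\<^esup> e\<^bsup>d t\<^esup> - 1) \<cdot> (\<Sum>a<d. \<chi> a \<xi>\<^bsup>a w\<^sub>i\<^esup> e\<^bsup>a t\<^esup>)\<close>,
  the two sides are, up to the factor \<open>n!\<close>, the coefficients of \<open>t\<^sup>n\<close> in
  \<open>F\<^sub>1 (w\<^sub>1 t) e\<^bsup>w\<^sub>1 w\<^sub>2 y\<^sub>1 t\<^esup> F\<^sub>2 (w\<^sub>2 t) e\<^bsup>w\<^sub>1 w\<^sub>2 y\<^sub>2 t\<^esup>\<close> and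
  \<open>F\<^sub>2 (w\<^sub>2 t) e\<^bsup>w\<^sub>1 w\<^sub>2 y\<^sub>1 t\<^esup> F\<^sub>1 (w\<^sub>1 t) e\<^bsup>w\<^sub>1 w\<^sub>2 y\<^sub>2 t\<^esup>\<close>,
  which agree because multiplication of power series is commutative.
\<close>

lemma subst_bivar_0 [simp]: "subst_bivar 0 g = 0"
  by (simp add: subst_bivar_def)

lemma subst_bivar_add: "subst_bivar (f + h) g = subst_bivar f g + subst_bivar h g"
proof -
  have "map_poly (\<lambda>c. [:[:c:]:]) (f + h) = map_poly (\<lambda>c. [:[:c:]:]) f + map_poly (\<lambda>c. [:[:c:]:]) h"
    by (rule poly_eqI) (simp add: coeff_map_poly)
  then show ?thesis
    by (simp add: subst_bivar_def)
qed

lemma subst_bivar_smult: "subst_bivar (smult c f) g = [:[:c:]:] * subst_bivar f g"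
proof -
  have "map_poly (\<lambda>c. [:[:c:]:]) (smult c f) = smult [:[:c:]:] (map_poly (\<lambda>c. [:[:c:]:]) f)"
    by (rule poly_eqI) (simp add: coeff_map_poly)
  then show ?thesis
    by (simp add: subst_bivar_def)
qed

lemma subst_bivar_sum: "subst_bivar (sum f A) g = (\<Sum>i\<in>A. subst_bivar (f i) g)"
  by (induction A rule: infinite_finite_induct) (simp_all add: subst_bivar_add)

lemma subst_bivar_monom: "subst_bivar (monom c k) g = [:[:c:]:] * g ^ k"
  by (simp add: subst_bivar_def map_poly_monom poly_monom)

text \<open>This is F(w t), with the coefficients of F embedded as constants. Taking
  \<open>fps_exp 1\<close> for F gives the exponential e^(w t) for any bivariate w.\<close>

definition fps_bivar_scale :: "'c::comm_ring_1 fps \<Rightarrow> 'c poly poly \<Rightarrow> 'c poly poly fps" where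
  "fps_bivar_scale F w = Abs_fps (\<lambda>i. [:[:fps_nth F i:]:] * w ^ i)"

text \<open>In F(t) e^(x t) only the exponential involves x, so putting x = g and then rescaling t
  to w t gives F(w t) e^(w g t).\<close>

lemma subst_bivar_appell:
  "subst_bivar (fps_nth (fps_lift_poly F * fps_exp_var) k) g * w ^ k =
   fps_nth (fps_bivar_scale F w * fps_bivar_scale (fps_exp 1) (w * g)) k"
proof -
  have "subst_bivar (fps_nth (fps_lift_poly F * fps_exp_var) k) g * w ^ k =
        (\<Sum>i=0..k. [:[:fps_nth F i:]:] * ([:[:1 / fact (k - i):]:] * g ^ (k - i)) * w ^ k)"
    by (simp add: fps_mult_nth fps_lift_poly_def fps_exp_var_def subst_bivar_sum subst_bivar_smult
        subst_bivar_monom sum_distrib_right)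
  also have "\<dots> = (\<Sum>i=0..k. ([:[:fps_nth F i:]:] * w ^ i) *
                        ([:[:1 / fact (k - i):]:] * (w * g) ^ (k - i)))"
  proof (rule sum.cong)
    fix i assume "i \<in> {0..k}"
    \<comment> \<open>The factor w^i rescales F and the rest rescales the exponential; i \<le> k
      keeps the subtraction exact.\<close>
    then have "w ^ k = w ^ i * w ^ (k - i)"
      by (simp flip: power_add)
    then show "[:[:fps_nth F i:]:] * ([:[:1 / fact (k - i):]:] * g ^ (k - i)) * w ^ k =
      ([:[:fps_nth F i:]:] * w ^ i) * ([:[:1 / fact (k - i):]:] * (w * g) ^ (k - i))"
      by (simp only: power_mult_distrib ac_simps)
  qed simp
  also have "\<dots> = fps_nth (fps_bivar_scale F w * fps_bivar_scale (fps_exp 1) (w * g)) k"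
    by (simp add: fps_mult_nth fps_bivar_scale_def)
  finally show ?thesis .
qed

text \<open>The generating function at x = 0, free of the polynomial variable.\<close>

definition twisted_bernoulli_number_fps ::
    "nat \<Rightarrow> (int \<Rightarrow> 'c::field_char_0) \<Rightarrow> 'c \<Rightarrow> 'c fps" where
  "twisted_bernoulli_number_fps d chi \<eta> = fps_X / twisted_denom d \<eta> * twisted_char_sum d chi \<eta>"

lemma subst_bivar_twisted_bernpoly:
  "subst_bivar (twisted_bernpoly d chi \<eta> k) g * w ^ k =
   [:[:fact k:]:] * fps_nth (fps_bivar_scale (twisted_bernoulli_number_fps d chi \<eta>) w *
     fps_bivar_scale (fps_exp 1) (w * g)) k"
proof -
  have "twisted_bernoulli_fps d chi \<eta> =
        fps_lift_poly (twisted_bernoulli_number_fps d chi \<eta>) * fps_exp_var"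
    by (simp only: twisted_bernoulli_fps_def twisted_bernoulli_number_fps_def
        fps_lift_poly_mult ac_simps)
  then show ?thesis
    by (simp only: twisted_bernpoly_def subst_bivar_smult mult.assoc subst_bivar_appell)
qed

lemma binomial_fact_poly_poly:
  assumes "k \<le> n"
  shows "of_nat (n choose k) * [:[:fact k:]:] * [:[:fact (n - k):]:] =
    [:[:fact n :: 'c::field_char_0:]:]"
proof -
  have "(of_nat (n choose k) * fact k * fact (n - k) :: 'c) = fact n"
    using assms by (simp add: binomial_fact)
  then show ?thesis
    by (simp add: of_nat_poly mult.assoc)
qed

text \<open>Binomial convolution is multiplication of exponential generating functions. All
  parameters are arbitrary, so both sides of the symmetry are instances.\<close>

lemma twisted_bernpoly_convolution:
  "(\<Sum>k\<le>n. of_nat (n choose k)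
      * subst_bivar (twisted_bernpoly d chi \<eta> k) g
      * subst_bivar (twisted_bernpoly d chi \<theta> (n - k)) h
      * u ^ k * v ^ (n - k)) =
   [:[:fact n:]:] * fps_nth
     (fps_bivar_scale (twisted_bernoulli_number_fps d chi \<eta>) u * fps_bivar_scale (fps_exp 1) (u * g) *
     (fps_bivar_scale (twisted_bernoulli_number_fps d chi \<theta>) v * fps_bivar_scale (fps_exp 1) (v * h))) n"
  (is "_ = _ * fps_nth (?F * ?G) n")
proof -
  have "of_nat (n choose k)
      * subst_bivar (twisted_bernpoly d chi \<eta> k) g
      * subst_bivar (twisted_bernpoly d chi \<theta> (n - k)) h
      * u ^ k * v ^ (n - k) = [:[:fact n:]:] * (fps_nth ?F k * fps_nth ?G (n - k))"
    (is "?L = _") if "k \<le> n" for k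
  proof -
    \<comment> \<open>Each power joins the polynomial with the same index, as
      \<open>subst_bivar_twisted_bernpoly\<close> requires.\<close>
    have "?L = of_nat (n choose k)
      * (subst_bivar (twisted_bernpoly d chi \<eta> k) g * u ^ k)
      * (subst_bivar (twisted_bernpoly d chi \<theta> (n - k)) h * v ^ (n - k))"
      by (simp only: ac_simps)
    also have "\<dots> = of_nat (n choose k) * [:[:fact k:]:] * [:[:fact (n - k):]:] *
        (fps_nth ?F k * fps_nth ?G (n - k))"
      unfolding subst_bivar_twisted_bernpoly by (simp only: ac_simps)
    finally show ?thesis
      by (simp only: binomial_fact_poly_poly[OF that])
  qed
  then show ?thesis
    by (simp add: fps_mult_nth sum_distrib_left atMost_atLeast0)
qed

theorem theorem1:
  fixes p d r w1 w2 n :: nat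
    and absv :: "'c::field_char_0 \<Rightarrow> real"
    and \<iota> :: "complex \<Rightarrow> 'c"
    and chi :: "int \<Rightarrow> complex"
    and \<xi> :: 'c
  assumes "padic_complex_field p absv"
    and "algebraic_embedding \<iota>"
    and "d > 0"
    and "primitive_dirichlet_character d chi"
    and "r > 0"
    and "coprime r (p * d)"
    and "\<xi> ^ r = 1"
    and "\<xi> \<noteq> 1"
    and "w1 > 0"
    and "w2 > 0"
    and "\<not> r dvd w1"
    and "\<not> r dvd w2"
  shows "(\<Sum>k\<le>n. of_nat (n choose k)
            * subst_bivar (twisted_bernpoly d (\<iota> \<circ> chi) (\<xi> ^ w1) k) (of_nat w2 * poly_y1)
            * subst_bivar (twisted_bernpoly d (\<iota> \<circ> chi) (\<xi> ^ w2) (n - k)) (of_nat w1 * poly_y2)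
            * of_nat w1 ^ k * of_nat w2 ^ (n - k)) =
         (\<Sum>k\<le>n. of_nat (n choose k)
            * subst_bivar (twisted_bernpoly d (\<iota> \<circ> chi) (\<xi> ^ w2) k) (of_nat w1 * poly_y1)
            * subst_bivar (twisted_bernpoly d (\<iota> \<circ> chi) (\<xi> ^ w1) (n - k)) (of_nat w2 * poly_y2)
            * of_nat w2 ^ k * of_nat w1 ^ (n - k))"
  \<comment> \<open>Commutativity acts at two levels: inside the exponentials, where w1 (w2 y1) = w2
    (w1 y1) and likewise for y2, and on the four series factors.\<close>
  unfolding twisted_bernpoly_convolution by (simp only: ac_simps)

end
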